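(* Let $T\in\mathcal{T}(n,m)$ be a weighted tree whose underlying tree is not the star $K_{1,n-1}$, and let $S\in\mathcal{T}(n,m)$ be the weighted star $K_{1,n-1}$ whose multiset of edge weights is the same as that of $T$. Then $S\prec T$, and hence $\mathbb{E}(S)<\mathbb{E}(T)$.
   Context: $\mathcal{T}(n,m)$ denotes the set of trees on $n$ vertices in which every edge has a positive integer weight and the sum of all edge weights equals $m$. The energy of a weighted graph $G$ is $\mathbb{E}(G)=\sum_i|\lambda_i|$, where $\lambda_i$ are the eigenvalues of the weighted adjacency matrix (the symmetric matrix whose $(i,j)$ entry is the weight of edge $ij$, or $0$ if there is no such edge). For a weighted bipartite graph $G$ of order $n$, $b_k(G)$ is the sum, over all $k$-edge matchings of $G$, of the product of the squares of the weights of the matching's edges. $G_1\preceq G_2$ means $b_k(G_1)\le b_k(G_2)$ for all $1\le k\le\lfloor n/2\rfloor$; $G_1\prec G_2$ means $G_1\preceq G_2$ and $b_j(G_1)<b_j(G_2)$ for some $j$. *)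

theory Defs
  imports
    "HOL-Library.Multiset"
    "HOL-Library.Disjoint_Sets"
    "Jordan_Normal_Form.Spectral_Radius"
begin

(* Weighted graphs on the vertex set {0..<nverts G}. An edge is a two-element set of vertices;
   the values of weight outside edges carry no meaning and are never inspected. *)
record wgraph =
  nverts :: nat
  edges :: "nat set set"
  weight :: "nat set \<Rightarrow> nat"

definition simple_graph :: "wgraph \<Rightarrow> bool" where
  "simple_graph G \<longleftrightarrow> (\<forall>e \<in> edges G. e \<subseteq> {..<nverts G} \<and> card e = 2)"

definition connected_graph :: "wgraph \<Rightarrow> bool" where
  "connected_graph G \<longleftrightarrow> 0 < nverts G \<and>
     (\<forall>u < nverts G. \<forall>v < nverts G. (\<lambda>x y. {x, y} \<in> edges G)\<^sup>*\<^sup>* u v)"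

definition is_cycle :: "wgraph \<Rightarrow> nat list \<Rightarrow> bool" where
  "is_cycle G vs \<longleftrightarrow> 3 \<le> length vs \<and> distinct vs \<and>
     (\<forall>i < length vs. {vs ! i, vs ! (Suc i mod length vs)} \<in> edges G)"

(* The tree predicate of AFP Graph_Theory forbids only directed cycles, so it is not used here. *)
definition is_tree :: "wgraph \<Rightarrow> bool" where
  "is_tree G \<longleftrightarrow> simple_graph G \<and> connected_graph G \<and> (\<nexists>vs. is_cycle G vs)"

definition weighted_trees :: "nat \<Rightarrow> nat \<Rightarrow> wgraph set" where
  "weighted_trees n m = {G. nverts G = n \<and> is_tree G \<and>
     (\<forall>e \<in> edges G. 0 < weight G e) \<and> (\<Sum>e \<in> edges G. weight G e) = m}"

(* The underlying graph is K_{1,n-1}, where n = nverts G; c is the centre. *)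
definition is_star :: "wgraph \<Rightarrow> bool" where
  "is_star G \<longleftrightarrow> (\<exists>c < nverts G. edges G = {{c, v} | v. v < nverts G \<and> v \<noteq> c})"

definition edge_weights :: "wgraph \<Rightarrow> nat multiset" where
  "edge_weights G = image_mset (weight G) (mset_set (edges G))"

definition adj_matrix :: "wgraph \<Rightarrow> complex mat" where
  "adj_matrix G = mat (nverts G) (nverts G)
     (\<lambda>(i, j). if {i, j} \<in> edges G then of_nat (weight G {i, j}) else 0)"

(* Eigenvalues are counted with multiplicity. For a simple graph the matrix is real symmetric, so
   all of them are real and cmod is the ordinary absolute value. *)
definition energy :: "wgraph \<Rightarrow> real" where
  "energy G = (\<Sum>x \<in> spectrum (adj_matrix G).
     real (Polynomial.order x (char_poly (adj_matrix G))) * cmod x)"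

definition matchings :: "wgraph \<Rightarrow> nat \<Rightarrow> nat set set set" where
  "matchings G k = {M. M \<subseteq> edges G \<and> disjoint M \<and> card M = k}"

definition match_coeff :: "nat \<Rightarrow> wgraph \<Rightarrow> nat" where
  "match_coeff k G = (\<Sum>M \<in> matchings G k. \<Prod>e \<in> M. (weight G e)\<^sup>2)"

(* The two relations are meant for graphs of the same order; this is part of the definition. *)
definition quasi_le :: "wgraph \<Rightarrow> wgraph \<Rightarrow> bool" where
  "quasi_le G H \<longleftrightarrow> nverts G = nverts H \<and>
     (\<forall>k \<in> {1..nverts G div 2}. match_coeff k G \<le> match_coeff k H)"

definition quasi_less :: "wgraph \<Rightarrow> wgraph \<Rightarrow> bool" where
  "quasi_less G H \<longleftrightarrow> quasi_le G H \<and>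
     (\<exists>j \<in> {1..nverts G div 2}. match_coeff j G < match_coeff j H)"

end

(* Let b be the sum of the squared edge weights, so the eigenvalues z_i satisfy sum z_i = 0 and
   sum z_i^2 = 2b. Then 2 * sum z_i^2 - (sum z_i)^2 = 4b is a sum of terms +-z_i z_j, whence
   (sum |z_i|)^2 >= 4b. Equality forces z_i^3 = b z_i for all i; then the symmetric matrix
   A^3 - b A has a square of trace 0, so A^3 = b A. A tree that is not a star contains an induced
   path on four vertices, whose ends are joined by a walk of length 3 but not adjacent, so the
   bound is strict. For a star every eigenvalue has square 0 or b, which gives equality. The same
   path provides a matching with two edges, whereas a star has none. *)
theory Submission
  imports Defs
begin

section \<open>Traces and triangular form\<close>

definition mtrace :: "complex mat \<Rightarrow> complex" where
  "mtrace A = (\<Sum>i<dim_row A. A $$ (i, i))"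

lemma mult_mat_index_sum:
  assumes "A \<in> carrier_mat n n" "B \<in> carrier_mat n n" "i < n" "j < n"
  shows "(A * B) $$ (i, j) = (\<Sum>k<n. A $$ (i, k) * B $$ (k, j))"
  using assms by (auto simp: scalar_prod_def lessThan_atLeast0 intro!: sum.cong)

lemma mtrace_mult:
  assumes "A \<in> carrier_mat n n" "B \<in> carrier_mat n n"
  shows "mtrace (A * B) = (\<Sum>i<n. \<Sum>j<n. A $$ (i, j) * B $$ (j, i))"
  using assms by (simp add: mtrace_def mult_mat_index_sum del: index_mult_mat(1))

lemma mtrace_mult_comm:
  assumes "A \<in> carrier_mat n n" "B \<in> carrier_mat n n"
  shows "mtrace (A * B) = mtrace (B * A)"
  unfolding mtrace_mult[OF assms] mtrace_mult[OF assms(2,1)]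
  by (subst sum.swap) (simp add: mult.commute)

lemma mtrace_similar:
  assumes "A \<in> carrier_mat n n" "similar_mat_wit A B P Q"
  shows "mtrace A = mtrace B"
proof -
  note w = similar_mat_witD2[OF assms]
  have "mtrace A = mtrace (P * (B * Q))" using w by simp
  also have "\<dots> = mtrace (B * Q * P)"
    using w by (intro mtrace_mult_comm[of _ n]) auto
  also have "B * Q * P = B * (Q * P)" using w by (intro assoc_mult_mat[of _ n n _ n _ n]) auto
  also have "\<dots> = B" using w by simp
  finally show ?thesis .
qed

lemma upper_triangular_mult:
  fixes A B :: "complex mat"
  assumes "A \<in> carrier_mat n n" "B \<in> carrier_mat n n" "upper_triangular A" "upper_triangular B"
  shows "upper_triangular (A * B)"
    and "i < n \<Longrightarrow> (A * B) $$ (i, i) = A $$ (i, i) * B $$ (i, i)"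
proof -
  \<comment> \<open>On or below the diagonal only the term with \<open>k = i = j\<close> survives:
    for \<open>k < i\<close> the first factor lies below the diagonal, otherwise
    \<open>j < k\<close> and the second one does.\<close>
  have z: "A $$ (i, k) * B $$ (k, j) = 0" if "i < n" "k < n" "j \<le> i" "k \<noteq> i \<or> j < i" for i j k
  proof (cases "k < i")
    case True
    then show ?thesis using upper_triangularD[OF assms(3), of k i] assms(1) that by simp
  next
    case False
    then have "j < k" using that by auto
    then show ?thesis using upper_triangularD[OF assms(4), of j k] assms(2) that by simp
  qed
  show "upper_triangular (A * B)"
  proof
    fix i j assume ij: "j < i" "i < dim_row (A * B)"
    have "(A * B) $$ (i, j) = (\<Sum>k<n. A $$ (i, k) * B $$ (k, j))"
      using assms(1,2) ij by (intro mult_mat_index_sum) auto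
    also have "\<dots> = 0" using z ij assms(1) by (intro sum.neutral) auto
    finally show "(A * B) $$ (i, j) = 0" .
  qed
  assume i: "i < n"
  have "(A * B) $$ (i, i) = (\<Sum>k<n. A $$ (i, k) * B $$ (k, i))"
    using assms(1,2) i by (intro mult_mat_index_sum) auto
  also have "\<dots> = (\<Sum>k<n. if k = i then A $$ (i, i) * B $$ (i, i) else 0)"
    using z[of i _ i] i by (intro sum.cong) auto
  finally show "(A * B) $$ (i, i) = A $$ (i, i) * B $$ (i, i)" using i by simp
qed

lemma upper_triangular_pow:
  fixes B :: "complex mat"
  assumes "B \<in> carrier_mat n n" "upper_triangular B"
  shows "upper_triangular (B ^\<^sub>m k) \<and> (\<forall>i<n. (B ^\<^sub>m k) $$ (i, i) = B $$ (i, i) ^ k)"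
proof (induction k)
  case 0
  show ?case using assms by auto
next
  case (Suc k)
  have "B ^\<^sub>m k \<in> carrier_mat n n" using assms by simp
  from upper_triangular_mult[OF this assms(1) _ assms(2)] Suc show ?case
    by (simp del: index_mult_mat(1))
qed

lemma pow_mat_add:
  assumes A: "A \<in> carrier_mat n n"
  shows "A ^\<^sub>m (k + l) = A ^\<^sub>m k * A ^\<^sub>m l"
proof (induction l)
  case (Suc l)
  then show ?case using assoc_mult_mat[of "A ^\<^sub>m k" n n "A ^\<^sub>m l" n A n] A by simp
qed (use A in simp)

text \<open>Links \<open>energy\<close>, which weights each distinct eigenvalue by its multiplicity,
  with a sum over the multiset of roots.\<close>

lemma sum_count_mult:
  fixes f :: "'a \<Rightarrow> real"
  shows "(\<Sum>x\<in>set_mset M. real (count M x) * f x) = (\<Sum>x\<in>#M. f x)"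
proof (induction M)
  case (add y M)
  have "(\<Sum>x\<in>set_mset (add_mset y M). real (count (add_mset y M) x) * f x)
      = (\<Sum>x\<in>insert y (set_mset M). real (count M x) * f x + (if x = y then f x else 0))"
    by (intro sum.cong) (auto simp: algebra_simps)
  also have "\<dots> = (\<Sum>x\<in>insert y (set_mset M). real (count M x) * f x) + f y"
    by (simp add: sum.distrib)
  also have "(\<Sum>x\<in>insert y (set_mset M). real (count M x) * f x)
      = (\<Sum>x\<in>set_mset M. real (count M x) * f x)"
    by (cases "y \<in># M") (auto simp: insert_absorb not_in_iff)
  finally show ?case using add by simp
qed simp

text \<open>The \<open>z i\<close> are the diagonal entries of a Schur triangular form: powers of a
  triangular matrix have powers on the diagonal, and similarity preserves the trace. One family
  serves all \<open>k\<close>, so traces of different powers can be combined termwise.\<close>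

lemma eigenvalue_enumeration:
  fixes A :: "complex mat"
  assumes A: "A \<in> carrier_mat n n"
  obtains z :: "nat \<Rightarrow> complex" where
    "\<And>k. mtrace (A ^\<^sub>m k) = (\<Sum>i<n. z i ^ k)"
    "\<And>i. i < n \<Longrightarrow> eigenvalue A (z i)"
    "(\<Sum>x \<in> spectrum A. real (Polynomial.order x (char_poly A)) * cmod x) = (\<Sum>i<n. cmod (z i))"
proof -
  obtain es where es: "char_poly A = (\<Prod>a\<leftarrow>es. [:- a, 1:])" "length es = n"
    using char_poly_factorized[OF A] by blast
  obtain B P Q where "schur_decomposition A es = (B, P, Q)" by (metis prod_cases3)
  from schur_decomposition[OF A es(1) this]
  have B: "similar_mat_wit A B P Q" "upper_triangular B" "diag_mat B = es" by auto
  have Bc: "B \<in> carrier_mat n n" using similar_mat_witD2[OF A B(1)] by auto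
  have esB: "es ! i = B $$ (i, i)" if "i < n" for i
    using B(3) Bc that by (auto simp: diag_mat_def)
  have nz: "char_poly A \<noteq> 0" unfolding es(1) by (auto simp: prod_list_zero_iff)
  have pr: "proots (char_poly A) = mset es"
  proof -
    have "proots (\<Prod>a\<leftarrow>es. [:- a, 1:]) = mset es"
      by (induction es) (auto simp: proots_mult prod_list_zero_iff image_iff simp del: mult_pCons_left)
    then show ?thesis using es by simp
  qed
  have spec: "spectrum A = set_mset (proots (char_poly A))"
    unfolding spectrum_def using nz by (auto simp: eigenvalue_root_char_poly[OF A])
  show ?thesis
  proof (rule that[of "\<lambda>i. es ! i"])
    fix k
    have Ak: "A ^\<^sub>m k \<in> carrier_mat n n" using A by simp
    have "mtrace (A ^\<^sub>m k) = mtrace (B ^\<^sub>m k)"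
      by (rule mtrace_similar[OF Ak similar_mat_wit_pow[OF B(1)]])
    also have "\<dots> = (\<Sum>i<n. es ! i ^ k)"
      using upper_triangular_pow[OF Bc B(2)] Bc esB by (simp add: mtrace_def)
    finally show "mtrace (A ^\<^sub>m k) = (\<Sum>i<n. es ! i ^ k)" .
  next
    fix i assume "i < n"
    then have "es ! i \<in> spectrum A" unfolding spec pr using es(2) by auto
    then show "eigenvalue A (es ! i)" by (simp add: spectrum_def)
  next
    have "(\<Sum>x \<in> spectrum A. real (Polynomial.order x (char_poly A)) * cmod x)
        = (\<Sum>x\<in>#proots (char_poly A). cmod x)"
      unfolding spec using sum_count_mult[of "proots (char_poly A)" cmod]
      by (simp only: count_proots[OF nz])
    also have "\<dots> = sum_list (map cmod es)"
      unfolding pr by (simp only: sum_mset_sum_list flip: mset_map)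
    also have "\<dots> = (\<Sum>i<n. cmod (es ! i))"
      using es(2) by (simp add: sum_list_sum_nth lessThan_atLeast0)
    finally show "(\<Sum>x \<in> spectrum A. real (Polynomial.order x (char_poly A)) * cmod x)
        = (\<Sum>i<n. cmod (es ! i))" .
  qed
qed

section \<open>Absolute sums of families with vanishing sum\<close>

lemma of_real_cmod_eq:
  assumes "cmod x = Re x"
  shows "x = of_real (cmod x)"
proof -
  have "Im x = 0" using cmod_power2[of x] assms by simp
  then show ?thesis using assms by (simp add: complex_eq_iff)
qed

text \<open>The bound is the triangle inequality for the double sum of the
  \<open>s i j * (z i * z j)\<close>, whose value is \<open>4 * b\<close>. In the equality case
  every term is a nonnegative real, and summing over one row gives a quadratic equation for
  \<open>z i\<close>.\<close>

lemma square_sum_cmod: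
  fixes z :: "nat \<Rightarrow> complex"
  assumes "(\<Sum>i<n. z i) = 0" "(\<Sum>i<n. z i ^ 2) = of_real (2 * b)"
  shows "4 * b \<le> (\<Sum>i<n. cmod (z i)) ^ 2"
    and "(\<Sum>i<n. cmod (z i)) ^ 2 = 4 * b \<Longrightarrow> i < n \<Longrightarrow> z i ^ 3 = of_real b * z i"
proof -
  let ?E = "\<Sum>i<n. cmod (z i)"
  \<comment> \<open>The signs for which every \<open>s i j * (z i * z j)\<close> has to be nonnegative in the equality case.\<close>
  define s where "s i j = (if i = j then 1 else - 1 :: complex)" for i j :: nat
  have row: "(\<Sum>j<n. s i j * (z i * z j)) = 2 * z i ^ 2" if "i < n" for i
  proof -
    have "(\<Sum>j<n. s i j * (z i * z j))
        = (\<Sum>j<n. (if j = i then 2 * z i ^ 2 else 0) - z i * z j)"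
      by (intro sum.cong) (auto simp: s_def power2_eq_square)
    also have "\<dots> = 2 * z i ^ 2 - z i * (\<Sum>j<n. z j)"
      using that by (simp add: sum_subtractf sum_distrib_left)
    finally show ?thesis using assms(1) by simp
  qed
  have cm: "cmod (s i j * (z i * z j)) = cmod (z i) * cmod (z j)" for i j
    by (simp add: s_def norm_mult)
  have E2: "?E ^ 2 = (\<Sum>i<n. \<Sum>j<n. cmod (s i j * (z i * z j)))"
    unfolding cm power2_eq_square by (rule sum_product)
  have "(\<Sum>i<n. \<Sum>j<n. s i j * (z i * z j)) = 2 * (\<Sum>i<n. z i ^ 2)"
    by (simp add: row sum_distrib_left)
  also have "\<dots> = of_real (4 * b)" using assms(2) by simp
  finally have "Re (\<Sum>i<n. \<Sum>j<n. s i j * (z i * z j)) = 4 * b" by simp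
  then have Re4: "(\<Sum>i<n. \<Sum>j<n. Re (s i j * (z i * z j))) = 4 * b" by (simp only: Re_sum)
  have le: "Re (s i j * (z i * z j)) \<le> cmod (s i j * (z i * z j))" for i j
    by (rule complex_Re_le_cmod)
  show "4 * b \<le> ?E ^ 2"
    unfolding E2 Re4[symmetric] by (intro sum_mono le)
  assume eq: "?E ^ 2 = 4 * b" and i: "i < n"
  have "(\<Sum>i<n. \<Sum>j<n. cmod (s i j * (z i * z j)) - Re (s i j * (z i * z j))) = 0"
    using eq E2 Re4 by (simp only: sum_subtractf)
  then have "cmod (s i j * (z i * z j)) - Re (s i j * (z i * z j)) = 0" if "j < n" for j
    using le i that by (simp add: sum_nonneg_eq_0_iff sum_nonneg)
  then have "s i j * (z i * z j) = of_real (cmod (z i) * cmod (z j))" if "j < n" for j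
    using that cm[of i j] of_real_cmod_eq[of "s i j * (z i * z j)"] by simp
  then have "(\<Sum>j<n. s i j * (z i * z j)) = of_real (cmod (z i) * ?E)"
    by (simp add: sum_distrib_left)
  with row[OF i] have sq: "2 * z i ^ 2 = of_real (cmod (z i) * ?E)" by simp
  show "z i ^ 3 = of_real b * z i"
  proof (cases "z i = 0")
    case False
    \<comment> \<open>Moduli show that every nonzero \<open>z i\<close> has modulus
      \<open>?E / 2\<close>; with \<open>?E ^ 2 = 4 * b\<close> the row equation then says that
      \<open>z i ^ 2\<close> is \<open>b\<close>.\<close>
    have "cmod (2 * z i ^ 2) = cmod (z i) * ?E"
      unfolding sq norm_of_real by (simp add: sum_nonneg)
    then have "?E = 2 * cmod (z i)"
      using False by (simp add: norm_mult norm_power power2_eq_square)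
    then have "cmod (z i) * ?E = 2 * b" using eq by (simp add: power2_eq_square)
    then have "2 * z i ^ 2 = of_real (2 * b)" unfolding sq by (rule arg_cong)
    then show ?thesis by (simp add: power3_eq_cube power2_eq_square)
  qed simp
qed

section \<open>Adjacency matrices\<close>

text \<open>The matrix entries as natural numbers, so that sums over walks can be compared by order;
  the guard discards weights outside edges.\<close>

definition adj_weight :: "wgraph \<Rightarrow> nat \<Rightarrow> nat \<Rightarrow> nat" where
  "adj_weight G i j = (if {i, j} \<in> edges G then weight G {i, j} else 0)"

text \<open>Both the first matching coefficient and, for simple graphs, half the trace of the
  squared adjacency matrix.\<close>

definition square_weight :: "wgraph \<Rightarrow> nat" where
  "square_weight G = (\<Sum>e \<in> edges G. (weight G e)\<^sup>2)"

lemma adj_weight_commute: "adj_weight G i j = adj_weight G j i"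
  by (simp add: adj_weight_def insert_commute)

lemma adj_matrix_carrier [simp]: "adj_matrix G \<in> carrier_mat (nverts G) (nverts G)"
  by (simp add: adj_matrix_def)

lemma dim_adj_matrix [simp]:
  "dim_row (adj_matrix G) = nverts G" "dim_col (adj_matrix G) = nverts G"
  by (simp_all add: adj_matrix_def)

lemma adj_matrix_index:
  "i < nverts G \<Longrightarrow> j < nverts G \<Longrightarrow> adj_matrix G $$ (i, j) = of_nat (adj_weight G i j)"
  by (simp add: adj_matrix_def adj_weight_def)

lemma finite_edges: "simple_graph G \<Longrightarrow> finite (edges G)"
  by (rule finite_subset[of _ "Pow {..<nverts G}"]) (auto simp: simple_graph_def)

lemma simple_graph_edgeD:
  "simple_graph G \<Longrightarrow> {x, y} \<in> edges G \<Longrightarrow> x < nverts G \<and> y < nverts G \<and> x \<noteq> y"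
  unfolding simple_graph_def by (metis card_2_iff' insert_iff insert_subset lessThan_iff singletonD)

text \<open>Double counting: each edge comes from exactly two ordered pairs of vertices.\<close>

lemma sum_adj_weight_square:
  assumes "simple_graph G"
  shows "(\<Sum>i<nverts G. \<Sum>j<nverts G. (adj_weight G i j)\<^sup>2) = 2 * square_weight G"
proof -
  let ?n = "nverts G"
  let ?P = "{..<?n} \<times> {..<?n}"
  have fib: "card {p \<in> ?P. {fst p, snd p} = e} = 2" if edge: "e \<in> edges G" for e
  proof -
    obtain a b where e: "e = {a, b}" "a \<noteq> b"
      using assms edge unfolding simple_graph_def by (meson card_2_iff)
    then have "a < ?n" "b < ?n" using simple_graph_edgeD[OF assms] edge by auto
    then have "{p \<in> ?P. {fst p, snd p} = e} = {(a, b), (b, a)}"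
      unfolding e(1) by (auto simp: doubleton_eq_iff)
    then show ?thesis using e(2) by simp
  qed
  have "(\<Sum>i<?n. \<Sum>j<?n. (adj_weight G i j)\<^sup>2) = (\<Sum>p\<in>?P. (adj_weight G (fst p) (snd p))\<^sup>2)"
    by (simp add: sum.cartesian_product case_prod_beta)
  also have "\<dots> = (\<Sum>p\<in>?P. \<Sum>e\<in>edges G. if {fst p, snd p} = e then (weight G e)\<^sup>2 else 0)"
    using finite_edges[OF assms] by (auto simp: adj_weight_def intro!: sum.cong)
  also have "\<dots> = (\<Sum>e\<in>edges G. \<Sum>p\<in>?P. if {fst p, snd p} = e then (weight G e)\<^sup>2 else 0)"
    by (rule sum.swap)
  also have "\<dots> = (\<Sum>e\<in>edges G. 2 * (weight G e)\<^sup>2)"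
  proof (intro sum.cong refl)
    fix e assume "e \<in> edges G"
    have "(\<Sum>p\<in>?P. if {fst p, snd p} = e then (weight G e)\<^sup>2 else 0)
        = card {p \<in> ?P. {fst p, snd p} = e} * (weight G e)\<^sup>2"
      by (subst sum.inter_filter[symmetric]) auto
    then show "(\<Sum>p\<in>?P. if {fst p, snd p} = e then (weight G e)\<^sup>2 else 0) = 2 * (weight G e)\<^sup>2"
      using fib[OF \<open>e \<in> edges G\<close>] by simp
  qed
  finally show ?thesis by (simp add: square_weight_def sum_distrib_left)
qed

text \<open>Entry of the cube of the adjacency matrix, bracketed like the matrix product: the total
  weight of the walks of length 3 from \<open>i\<close> to \<open>j\<close>.\<close>

definition walk3_weight :: "wgraph \<Rightarrow> nat \<Rightarrow> nat \<Rightarrow> nat" where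
  "walk3_weight G i j =
     (\<Sum>k<nverts G. (\<Sum>l<nverts G. adj_weight G i l * adj_weight G l k) * adj_weight G k j)"

lemma walk3_weight_commute: "walk3_weight G i j = walk3_weight G j i"
  unfolding walk3_weight_def sum_distrib_right
  by (subst sum.swap) (simp add: adj_weight_commute mult_ac)

lemma adj_matrix_cube_index:
  assumes "i < nverts G" "j < nverts G"
  shows "(adj_matrix G ^\<^sub>m 3) $$ (i, j) = of_nat (walk3_weight G i j)"
proof -
  let ?A = "adj_matrix G"
  have "?A ^\<^sub>m 3 = ?A * ?A * ?A" by (simp add: numeral_3_eq_3)
  moreover have "?A * ?A \<in> carrier_mat (nverts G) (nverts G)"
    by (rule mult_carrier_mat[OF adj_matrix_carrier adj_matrix_carrier])
  ultimately show ?thesis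
    using assms
    by (simp add: mult_mat_index_sum[of _ "nverts G"] adj_matrix_index walk3_weight_def
        del: index_mult_mat(1))
qed

text \<open>Exponents 1 and 2 feed the energy bound; 2, 4 and 6 expand the trace of the square of
  \<open>A^3 - b A\<close>. By symmetry the trace of a product of two powers is the sum of the
  products of their corresponding entries.\<close>

lemma mtrace_adj_matrix:
  assumes "simple_graph G"
  shows "mtrace (adj_matrix G ^\<^sub>m 1) = 0"
    and "mtrace (adj_matrix G ^\<^sub>m 2) = of_nat (2 * square_weight G)"
    and "mtrace (adj_matrix G ^\<^sub>m 4)
      = of_nat (\<Sum>i<nverts G. \<Sum>j<nverts G. walk3_weight G i j * adj_weight G i j)"
    and "mtrace (adj_matrix G ^\<^sub>m 6)
      = of_nat (\<Sum>i<nverts G. \<Sum>j<nverts G. walk3_weight G i j * walk3_weight G i j)"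
proof -
  let ?A = "adj_matrix G" and ?n = "nverts G"
  have A: "?A \<in> carrier_mat ?n ?n" by simp
  have A3: "?A ^\<^sub>m 3 \<in> carrier_mat ?n ?n" using A by (rule pow_carrier_mat)
  have "?A $$ (i, i) = 0" if "i < ?n" for i
    using that simple_graph_edgeD[OF assms, of i i] by (auto simp: adj_matrix_index adj_weight_def)
  then show "mtrace (?A ^\<^sub>m 1) = 0" using A by (simp add: mtrace_def)
  have "?A ^\<^sub>m 2 = ?A * ?A" by (simp add: numeral_2_eq_2)
  then have "mtrace (?A ^\<^sub>m 2) = of_nat (\<Sum>i<?n. \<Sum>j<?n. (adj_weight G i j)\<^sup>2)"
    by (simp add: mtrace_mult[OF A A] adj_matrix_index power2_eq_square adj_weight_commute)
  then show "mtrace (?A ^\<^sub>m 2) = of_nat (2 * square_weight G)"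
    unfolding sum_adj_weight_square[OF assms] .
  have "?A ^\<^sub>m 4 = ?A ^\<^sub>m 3 * ?A" by (simp add: numeral_eq_Suc)
  then show "mtrace (?A ^\<^sub>m 4) = of_nat (\<Sum>i<?n. \<Sum>j<?n. walk3_weight G i j * adj_weight G i j)"
    by (simp add: mtrace_mult[OF A3 A] adj_matrix_index adj_matrix_cube_index)
       (simp add: adj_weight_commute)
  have "?A ^\<^sub>m 6 = ?A ^\<^sub>m 3 * ?A ^\<^sub>m 3"
    using pow_mat_add[OF A, of 3 3] by simp
  then show "mtrace (?A ^\<^sub>m 6) = of_nat (\<Sum>i<?n. \<Sum>j<?n. walk3_weight G i j * walk3_weight G i j)"
    by (simp add: mtrace_mult[OF A3 A3] adj_matrix_cube_index)
       (simp add: walk3_weight_commute)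
qed

text \<open>In the equality case the eigenvalue equation is carried over to matrix entries without
  diagonalisation: for the symmetric matrix \<open>A^3 - b A\<close> the trace of the square is the
  sum of the squared entries.\<close>

lemma energy_lower_bound:
  assumes "simple_graph G"
  shows "4 * real (square_weight G) \<le> (energy G)\<^sup>2"
    and "(energy G)\<^sup>2 = 4 * real (square_weight G) \<Longrightarrow> i < nverts G \<Longrightarrow> j < nverts G \<Longrightarrow>
      walk3_weight G i j = square_weight G * adj_weight G i j"
proof -
  let ?n = "nverts G"
  let ?b = "square_weight G"
  obtain z where tr: "\<And>k. mtrace (adj_matrix G ^\<^sub>m k) = (\<Sum>i<?n. z i ^ k)"
    and en: "energy G = (\<Sum>i<?n. cmod (z i))"
    by (rule eigenvalue_enumeration[OF adj_matrix_carrier[of G], folded energy_def]) blast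
  have s1: "(\<Sum>i<?n. z i) = 0" using tr[of 1] mtrace_adj_matrix(1)[OF assms] by simp
  have s2: "(\<Sum>i<?n. z i ^ 2) = of_real (2 * real ?b)"
    using tr[of 2] mtrace_adj_matrix(2)[OF assms] by simp
  show "4 * real ?b \<le> (energy G)\<^sup>2" unfolding en by (rule square_sum_cmod(1)[OF s1 s2])
  assume "(energy G)\<^sup>2 = 4 * real ?b" and ij: "i < ?n" "j < ?n"
  then have z3: "z i ^ 3 = of_real (real ?b) * z i" if "i < ?n" for i
    using square_sum_cmod(2)[OF s1 s2] that unfolding en by blast
  \<comment> \<open>Entry of \<open>A^3 - b A\<close>, taken in the integers because subtraction of
    naturals truncates.\<close>
  let ?c = "\<lambda>i j. int (walk3_weight G i j) - int ?b * int (adj_weight G i j)"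
  have "of_int (\<Sum>i<?n. \<Sum>j<?n. (?c i j)\<^sup>2)
      = mtrace (adj_matrix G ^\<^sub>m 6) - 2 * of_nat ?b * mtrace (adj_matrix G ^\<^sub>m 4)
        + of_nat ?b ^ 2 * of_nat (\<Sum>i<?n. \<Sum>j<?n. (adj_weight G i j)\<^sup>2)"
    unfolding mtrace_adj_matrix(3,4)[OF assms]
    by (simp add: sum_distrib_left power2_eq_square algebra_simps flip: sum.distrib sum_subtractf)
  also have "\<dots> = (\<Sum>i<?n. z i ^ 6) - 2 * of_nat ?b * (\<Sum>i<?n. z i ^ 4)
        + of_nat ?b ^ 2 * (\<Sum>i<?n. z i ^ 2)"
    using mtrace_adj_matrix(2)[OF assms] by (simp add: tr sum_adj_weight_square[OF assms])
  also have "\<dots> = (\<Sum>i<?n. (z i ^ 3 - of_nat ?b * z i) ^ 2)"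
    by (simp add: sum_distrib_left power2_eq_square algebra_simps eval_nat_numeral
        flip: sum.distrib sum_subtractf)
  also have "\<dots> = 0" using z3 by simp
  finally have "(\<Sum>i<?n. \<Sum>j<?n. (?c i j)\<^sup>2) = 0" by (simp only: of_int_eq_0_iff)
  then have "?c i j = 0" using ij by (simp add: sum_nonneg_eq_0_iff sum_nonneg)
  then show "walk3_weight G i j = ?b * adj_weight G i j" by (simp flip: of_nat_mult)
qed

section \<open>Stars\<close>

lemma star_adj_weight:
  assumes "simple_graph G" "edges G = {{c, v} | v. v < nverts G \<and> v \<noteq> c}" "c < nverts G"
  shows "i \<noteq> c \<Longrightarrow> j \<noteq> c \<Longrightarrow> adj_weight G i j = 0" "adj_weight G c c = 0"
  by (auto simp: adj_weight_def assms(2) doubleton_eq_iff)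

lemma star_square_weight:
  assumes "simple_graph G" "edges G = {{c, v} | v. v < nverts G \<and> v \<noteq> c}" "c < nverts G"
  shows "square_weight G = (\<Sum>j<nverts G. (adj_weight G c j)\<^sup>2)"
proof -
  have e: "edges G = (\<lambda>v. {c, v}) ` ({..<nverts G} - {c})" using assms(2) by auto
  have "square_weight G = (\<Sum>j\<in>{..<nverts G} - {c}. (weight G {c, j})\<^sup>2)"
    unfolding square_weight_def e
    by (subst sum.reindex) (auto simp: inj_on_def doubleton_eq_iff)
  also have "\<dots> = (\<Sum>j\<in>{..<nverts G} - {c}. (adj_weight G c j)\<^sup>2)"
    by (intro sum.cong) (auto simp: adj_weight_def assms(2))
  also have "\<dots> = (\<Sum>j<nverts G. (adj_weight G c j)\<^sup>2)"
    using star_adj_weight(2)[OF assms] assms(3) by (intro sum.mono_neutral_left) auto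
  finally show ?thesis .
qed

text \<open>At a leaf the eigenvector equation involves only the centre. Inserting it into
  \<open>x\<close> times the equation at the centre gives a scalar equation for
  \<open>v $ c\<close>; if \<open>v $ c = 0\<close>, a nonzero component at a leaf forces
  \<open>x = 0\<close>.\<close>

lemma star_eigenvalue:
  assumes "simple_graph G" "is_star G" "eigenvalue (adj_matrix G) x"
  shows "x = 0 \<or> x\<^sup>2 = of_nat (square_weight G)"
proof -
  let ?n = "nverts G"
  obtain c where c: "c < ?n" and E: "edges G = {{c, v} | v. v < ?n \<and> v \<noteq> c}"
    using assms(2) by (auto simp: is_star_def)
  note st = star_adj_weight[OF assms(1) E c]
  obtain v where v: "v \<in> carrier_vec ?n" "v \<noteq> 0\<^sub>v ?n" "adj_matrix G *\<^sub>v v = x \<cdot>\<^sub>v v"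
    using assms(3) by (auto simp: eigenvalue_def eigenvector_def adj_matrix_def)
  have ev: "x * v $ i = (\<Sum>j<?n. of_nat (adj_weight G i j) * v $ j)" if "i < ?n" for i
  proof -
    have "x * v $ i = (adj_matrix G *\<^sub>v v) $ i" using v that by simp
    also have "\<dots> = (\<Sum>j<?n. adj_matrix G $$ (i, j) * v $ j)"
      using v(1) that adj_matrix_carrier[of G]
      by (auto simp: scalar_prod_def lessThan_atLeast0 intro!: sum.cong)
    finally show ?thesis using that by (simp add: adj_matrix_index)
  qed
  have leaf: "x * v $ i = of_nat (adj_weight G c i) * v $ c" if "i < ?n" "i \<noteq> c" for i
  proof -
    have "x * v $ i = (\<Sum>j<?n. if j = c then of_nat (adj_weight G i c) * v $ c else 0)"
      unfolding ev[OF that(1)] using st(1)[OF that(2)] by (intro sum.cong) auto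
    then show ?thesis using c by (simp add: adj_weight_commute)
  qed
  have "x\<^sup>2 * v $ c = x * (\<Sum>j<?n. of_nat (adj_weight G c j) * v $ j)"
    using ev[OF c] by (simp add: power2_eq_square mult.assoc)
  also have "\<dots> = (\<Sum>j<?n. of_nat (adj_weight G c j) * (x * v $ j))"
    by (simp add: sum_distrib_left mult_ac)
  also have "\<dots> = (\<Sum>j<?n. of_nat ((adj_weight G c j)\<^sup>2) * v $ c)"
  proof (intro sum.cong refl)
    fix j assume "j \<in> {..<?n}"
    then show "of_nat (adj_weight G c j) * (x * v $ j) = of_nat ((adj_weight G c j)\<^sup>2) * v $ c"
      using leaf[of j] st(2) by (cases "j = c") (auto simp: power2_eq_square)
  qed
  also have "\<dots> = of_nat (square_weight G) * v $ c"
    unfolding star_square_weight[OF assms(1) E c] by (simp add: sum_distrib_right)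
  finally have centre: "x\<^sup>2 * v $ c = of_nat (square_weight G) * v $ c" .
  show ?thesis
  proof (cases "v $ c = 0")
    case True
    obtain i where i: "i < ?n" "v $ i \<noteq> 0" using v(1,2) by (metis carrier_vecD eq_vecI index_zero_vec)
    with leaf[of i] True have "x * v $ i = 0" by auto
    then show ?thesis using i by simp
  qed (use centre in simp)
qed

text \<open>Each eigenvalue is 0 or has square \<open>b\<close>, so its square equals
  \<open>sqrt b\<close> times its modulus. Summing and comparing with the trace of the squared
  matrix gives \<open>sqrt b * energy G = 2 * b\<close>.\<close>

lemma star_energy:
  assumes "simple_graph G" "is_star G"
  shows "(energy G)\<^sup>2 \<le> 4 * real (square_weight G)"
proof -
  let ?n = "nverts G"
  let ?b = "real (square_weight G)"
  obtain z where tr: "\<And>k. mtrace (adj_matrix G ^\<^sub>m k) = (\<Sum>i<?n. z i ^ k)"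
    and ev: "\<And>i. i < ?n \<Longrightarrow> eigenvalue (adj_matrix G) (z i)"
    and en: "energy G = (\<Sum>i<?n. cmod (z i))"
    by (rule eigenvalue_enumeration[OF adj_matrix_carrier[of G], folded energy_def]) blast
  have "complex_of_real (sqrt ?b * cmod (z i)) = z i ^ 2" if "i < ?n" for i
  proof (cases "z i = 0")
    case False
    then have sq: "z i ^ 2 = of_real ?b" using star_eigenvalue[OF assms ev[OF that]] by simp
    have "cmod (z i) ^ 2 = ?b" by (simp flip: norm_power add: sq)
    then have "cmod (z i) = sqrt ?b" using real_sqrt_unique[of "cmod (z i)" ?b] by simp
    then show ?thesis by (simp add: sq)
  qed simp
  then have "complex_of_real (\<Sum>i<?n. sqrt ?b * cmod (z i)) = (\<Sum>i<?n. z i ^ 2)" by simp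
  also have "\<dots> = of_real (2 * ?b)"
    using tr[of 2] mtrace_adj_matrix(2)[OF assms(1)] by simp
  finally have *: "sqrt ?b * energy G = 2 * ?b"
    unfolding en sum_distrib_left by (simp only: of_real_eq_iff)
  show ?thesis
  proof (cases "?b = 0")
    \<comment> \<open>Here the summed identity is trivial, but all eigenvalues vanish.\<close>
    case True
    then have "z i = 0" if "i < ?n" for i using star_eigenvalue[OF assms ev[OF that]] by simp
    then show ?thesis by (simp add: en)
  next
    case False
    have "?b * (energy G)\<^sup>2 = (sqrt ?b * energy G)\<^sup>2" by (simp add: power_mult_distrib)
    also have "\<dots> = ?b * (4 * ?b)" unfolding * by (simp add: power2_eq_square)
    finally show ?thesis using False by simp
  qed
qed

section \<open>Induced paths in trees\<close>

lemma is_cycle_triangle: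
  assumes "{x, y} \<in> edges G" "{y, z} \<in> edges G" "{z, x} \<in> edges G" "distinct [x, y, z]"
  shows "is_cycle G [x, y, z]"
  using assms unfolding is_cycle_def numeral_3_eq_3 by (simp add: All_less_Suc)

lemma is_cycle_quadrangle:
  assumes "{x, y} \<in> edges G" "{y, z} \<in> edges G" "{z, w} \<in> edges G" "{w, x} \<in> edges G"
    "distinct [x, y, z, w]"
  shows "is_cycle G [x, y, z, w]"
  using assms unfolding is_cycle_def numeral_3_eq_3 by (simp add: All_less_Suc)

lemma connected_graph_obtains_edge:
  assumes "connected_graph G" "1 < nverts G"
  obtains a b where "{a, b} \<in> edges G"
proof -
  have "(\<lambda>x y. {x, y} \<in> edges G)\<^sup>*\<^sup>* 0 1" using assms by (auto simp: connected_graph_def)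
  then show ?thesis by (cases rule: converse_rtranclpE) (use that in auto)
qed

text \<open>By contraposition: without such a path the ends of every walk of length 3 are adjacent,
  and acyclicity then makes the neighbour of a leaf adjacent to all other vertices.\<close>

lemma tree_induced_path:
  assumes "is_tree G" "\<not> is_star G"
  obtains (path) a b c d where "{a, b} \<in> edges G" "{b, c} \<in> edges G" "{c, d} \<in> edges G"
    "{a, d} \<notin> edges G" "distinct [a, b, c, d]"
proof (rule ccontr)
  assume contr: "\<not> thesis"
  have s: "simple_graph G" and con: "connected_graph G" and nc: "\<And>vs. \<not> is_cycle G vs"
    using assms(1) by (auto simp: is_tree_def)
  note eD = simple_graph_edgeD[OF s]
  have tri: False if "{x, y} \<in> edges G" "{y, z} \<in> edges G" "{z, x} \<in> edges G" for x y z
    using is_cycle_triangle[OF that] that nc eD by (metis distinct_length_2_or_more distinct_singleton)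
  \<comment> \<open>The walk may repeat vertices: if \<open>x = z\<close> or \<open>y = w\<close>,
    the edge is already on the walk, and \<open>x = w\<close> would give a triangle.\<close>
  have closed: "{x, w} \<in> edges G"
    if "{x, y} \<in> edges G" "{y, z} \<in> edges G" "{z, w} \<in> edges G" for x y z w
  proof (rule ccontr)
    assume n: "{x, w} \<notin> edges G"
    have "x \<noteq> y" "y \<noteq> z" "z \<noteq> w" using that eD by auto
    moreover have "x \<noteq> z" "y \<noteq> w" using n that by (auto simp: insert_commute)
    moreover have "x \<noteq> w" using tri[of x y z] that by auto
    ultimately show False using that n contr path[of x y z w] by auto
  qed
  have "is_star G"
  proof (cases "1 < nverts G")
    case False
    \<comment> \<open>A single vertex without edges counts as a star.\<close>
    then have n1: "nverts G = 1" using con by (auto simp: connected_graph_def)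
    then have "edges G = {}" using s by (fastforce simp: simple_graph_def dest: card_mono[rotated])
    then show ?thesis using n1 by (auto simp: is_star_def)
  next
    case True
    obtain a0 b0 where "{a0, b0} \<in> edges G" using connected_graph_obtains_edge[OF con True] by blast
    \<comment> \<open>A leaf \<open>b\<close> with neighbour \<open>a\<close>: if both ends of the
      edge \<open>{a0, b0}\<close> had a further neighbour, \<open>closed\<close> would join these
      two into a 4-cycle.\<close>
    have "\<exists>a b. {a, b} \<in> edges G \<and> (\<forall>y. {y, b} \<in> edges G \<longrightarrow> y = a)"
    proof (rule ccontr)
      assume "\<not> ?thesis"
      then have *: "\<And>a b. {a, b} \<in> edges G \<Longrightarrow> \<exists>y. {y, b} \<in> edges G \<and> y \<noteq> a" by blast
      obtain y where y: "{y, b0} \<in> edges G" "y \<noteq> a0" using * \<open>{a0, b0} \<in> edges G\<close> by blast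
      obtain x where x: "{x, a0} \<in> edges G" "x \<noteq> b0"
        using *[of b0 a0] \<open>{a0, b0} \<in> edges G\<close> by (auto simp: insert_commute)
      have xy: "{x, y} \<in> edges G"
        using closed[of x a0 b0 y] x y \<open>{a0, b0} \<in> edges G\<close> by (auto simp: insert_commute)
      have "is_cycle G [x, a0, b0, y]"
        using x y xy \<open>{a0, b0} \<in> edges G\<close> eD[OF xy] eD[OF x(1)] eD[OF y(1)] eD[of a0 b0]
        by (intro is_cycle_quadrangle) (auto simp: insert_commute)
      then show False using nc by blast
    qed
    then obtain a b where ab: "{a, b} \<in> edges G" and leaf: "\<And>y. {y, b} \<in> edges G \<Longrightarrow> y = a"
      by blast
    \<comment> \<open>Along a path the vertices are adjacent to \<open>a\<close> and to
      \<open>b\<close> in turn: from \<open>y\<close> next to \<open>a\<close>, the walk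
      \<open>w, y, a, b\<close> closes up. As \<open>b\<close> is a leaf, adjacency to
      \<open>b\<close> means \<open>v = a\<close>.\<close>
    have reach: "{v, a} \<in> edges G \<or> {v, b} \<in> edges G"
      if "(\<lambda>x y. {x, y} \<in> edges G)\<^sup>*\<^sup>* a v" for v
      using that
    proof (induction rule: rtranclp_induct)
      case (step y w)
      then show ?case using closed[of w y a b] closed[of w y b a] ab by (auto simp: insert_commute)
    qed (use ab in simp)
    have av: "{a, v} \<in> edges G" if "v < nverts G" "v \<noteq> a" for v
      using reach[of v] con that leaf[of v] eD[OF ab]
      by (auto simp: connected_graph_def insert_commute)
    have "e \<in> {{a, v} | v. v < nverts G \<and> v \<noteq> a}" if e: "e \<in> edges G" for e
    proof -
      obtain u v where uv: "e = {u, v}"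
        using s e unfolding simple_graph_def by (metis card_2_iff)
      \<comment> \<open>An edge avoiding \<open>a\<close> would form a triangle with
        \<open>a\<close>.\<close>
      have "u = a \<or> v = a"
        using tri[of a u v] av[of u] av[of v] eD[of u v] e uv by (auto simp: insert_commute)
      then show ?thesis using uv eD[of u v] e by (auto simp: insert_commute)
    qed
    then have "edges G = {{a, v} | v. v < nverts G \<and> v \<noteq> a}" using av by blast
    then show ?thesis using eD[OF ab] by (auto simp: is_star_def)
  qed
  with assms(2) show False by simp
qed

text \<open>Equality would make the entry of \<open>A^3\<close> at the ends of the induced path a
  multiple of a zero entry of \<open>A\<close>, while the path itself contributes a positive term to
  it.\<close>

lemma tree_energy:
  assumes "is_tree G" "\<not> is_star G" "\<And>e. e \<in> edges G \<Longrightarrow> 0 < weight G e"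
  shows "4 * real (square_weight G) < (energy G)\<^sup>2"
proof (rule ccontr)
  assume "\<not> ?thesis"
  moreover have s: "simple_graph G" using assms(1) by (simp add: is_tree_def)
  ultimately have eq: "(energy G)\<^sup>2 = 4 * real (square_weight G)"
    using energy_lower_bound(1)[OF s] by simp
  obtain a b c d where p: "{a, b} \<in> edges G" "{b, c} \<in> edges G" "{c, d} \<in> edges G"
    "{a, d} \<notin> edges G" using tree_induced_path[OF assms(1,2)] by metis
  note bd = simple_graph_edgeD[OF s p(1)] simple_graph_edgeD[OF s p(3)]
  have "0 < adj_weight G a b * adj_weight G b c" "0 < adj_weight G c d"
    using p assms(3) by (auto simp: adj_weight_def)
  moreover have "adj_weight G a b * adj_weight G b c
      \<le> (\<Sum>l<nverts G. adj_weight G a l * adj_weight G l c)"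
    using bd by (intro member_le_sum) auto
  ultimately have "0 < (\<Sum>l<nverts G. adj_weight G a l * adj_weight G l c) * adj_weight G c d"
    by (metis less_le_trans nat_0_less_mult_iff)
  also have "\<dots> \<le> walk3_weight G a d"
    unfolding walk3_weight_def using bd
    by (intro member_le_sum[of c _ "\<lambda>k. (\<Sum>l<nverts G. adj_weight G a l * adj_weight G l k) * adj_weight G k d"]) auto
  also have "\<dots> = 0"
    using energy_lower_bound(2)[OF s eq, of a d] bd p(4) by (simp add: adj_weight_def)
  finally show False by simp
qed

section \<open>Matchings\<close>

lemma match_coeff_1: "match_coeff 1 G = square_weight G"
proof -
  have "matchings G 1 = (\<lambda>e. {e}) ` edges G"
    by (auto simp: matchings_def card_1_singleton_iff disjoint_def)
  then show ?thesis by (simp add: match_coeff_def square_weight_def sum.reindex)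
qed

text \<open>Equal weight multisets therefore give equal values of \<open>b\<close>, the only
  quantity shared by the two energy estimates.\<close>

lemma square_weight_edge_weights: "square_weight G = (\<Sum>w\<in>#edge_weights G. w\<^sup>2)"
  by (simp add: square_weight_def edge_weights_def sum_unfold_sum_mset image_mset.compositionality o_def)

lemma star_match_coeff:
  assumes "is_star G" "2 \<le> k"
  shows "match_coeff k G = 0"
proof -
  obtain c where E: "edges G = {{c, v} | v. v < nverts G \<and> v \<noteq> c}"
    using assms(1) by (auto simp: is_star_def)
  have "M \<notin> matchings G k" for M
  proof
    assume M: "M \<in> matchings G k"
    have "e = f" if "e \<in> M" "f \<in> M" for e f
      using M that disjointD[of M e f] unfolding matchings_def E by auto
    \<comment> \<open>Any two edges share the centre, so \<open>M\<close> has at most one element;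
      an infinite \<open>M\<close> would have \<open>card\<close> 0 by convention.\<close>
    then have "card M \<le> Suc 0"
      by (cases "finite M") (simp_all add: card_le_Suc0_iff_eq)
    then show False using M assms(2) by (simp add: matchings_def)
  qed
  then have "matchings G k = {}" by blast
  then show ?thesis by (simp add: match_coeff_def)
qed

text \<open>The end edges of the induced path form the matching. The bound on the order puts the
  index 2 into the range that \<open>quasi_less\<close> inspects.\<close>

lemma tree_match_coeff_2:
  assumes "is_tree G" "\<not> is_star G" "\<And>e. e \<in> edges G \<Longrightarrow> 0 < weight G e"
  shows "0 < match_coeff 2 G" "4 \<le> nverts G"
proof -
  have s: "simple_graph G" using assms(1) by (simp add: is_tree_def)
  obtain a b c d where p: "{a, b} \<in> edges G" "{c, d} \<in> edges G" "distinct [a, b, c, d]"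
    using tree_induced_path[OF assms(1,2)] by metis
  have "{a, b, c, d} \<subseteq> {..<nverts G}"
    using simple_graph_edgeD[OF s p(1)] simple_graph_edgeD[OF s p(2)] by auto
  from card_mono[OF _ this] show "4 \<le> nverts G" using p(3) by simp
  have M: "{{a, b}, {c, d}} \<in> matchings G 2"
    using p by (auto simp: matchings_def disjoint_def doubleton_eq_iff)
  have fin: "finite (matchings G 2)"
    by (rule finite_subset[of _ "Pow (edges G)"]) (auto simp: matchings_def finite_edges[OF s])
  have "0 < (\<Prod>e\<in>{{a, b}, {c, d}}. (weight G e)\<^sup>2)"
    using p(1,2) assms(3) by (intro prod_pos) auto
  also have "\<dots> \<le> match_coeff 2 G"
    unfolding match_coeff_def using M fin
    by (intro member_le_sum[of _ _ "\<lambda>M. \<Prod>e\<in>M. (weight G e)\<^sup>2"]) auto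
  finally show "0 < match_coeff 2 G" .
qed

section \<open>Comparison of the star with the tree\<close>

theorem theorem4:
  fixes n m :: nat and S T :: wgraph
  assumes "T \<in> weighted_trees n m"
    and "\<not> is_star T"
    and "S \<in> weighted_trees n m"
    and "is_star S"
    and "edge_weights S = edge_weights T"
  shows "quasi_less S T \<and> energy S < energy T"
proof
  have T: "nverts T = n" "is_tree T" "\<And>e. e \<in> edges T \<Longrightarrow> 0 < weight T e"
    and S: "nverts S = n" "simple_graph S"
    using assms(1,3) by (auto simp: weighted_trees_def is_tree_def)
  have b: "square_weight S = square_weight T"
    by (simp add: square_weight_edge_weights assms(5))
  note T2 = tree_match_coeff_2[OF T(2) assms(2) T(3)]
  have "match_coeff k S \<le> match_coeff k T" if "k \<in> {1..n div 2}" for k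
  proof (cases "k = 1")
    case True
    then show ?thesis using b by (simp only: match_coeff_1)
  next
    case False
    with that show ?thesis using star_match_coeff[OF assms(4), of k] by simp
  qed
  moreover have "match_coeff 2 S < match_coeff 2 T"
    using T2(1) star_match_coeff[OF assms(4)] by simp
  moreover have "2 \<in> {1..n div 2}" using T2(2) T(1) by auto
  ultimately show "quasi_less S T"
    unfolding quasi_less_def quasi_le_def T(1) S(1) by blast
  have "(energy S)\<^sup>2 < (energy T)\<^sup>2"
    using star_energy[OF S(2) assms(4)] tree_energy[OF T(2) assms(2) T(3)] b by simp
  then show "energy S < energy T"
    \<comment> \<open>Passing from the squares to the energies needs \<open>energy T\<close> to be
      nonnegative.\<close>
    by (rule power_less_imp_less_base) (auto simp: energy_def intro!: sum_nonneg)
qed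

end
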